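(* Let $b>-1$ be real and for integers $n\ge 0$ let $$Q_n(x)=x\,(1-x^2)^{b/2}\,\bar S_n(x),$$ where $\bar S_n$ is the monic generalized ultraspherical polynomial with parameters $u=1$, $v=b$ (defined in the context). Then $\Phi_n=Q_n$ satisfies $$(1-x^2)\Phi_n''(x)-2x\Phi_n'(x)+\Big((n+b+1)(n+b+2)-\frac{b^2}{1-x^2}-\frac{1-(-1)^n}{2}\cdot\frac{2}{x^2}\Big)\Phi_n(x)=0,$$ and for all integers $n,m\ge 0$ $$\int_{-1}^{1}Q_n(x)Q_m(x)\,dx=\Bigg(\prod_{i=1}^{n}\frac{\big(i+1-(-1)^i\big)\big(i+1-(-1)^i+2b\big)}{(2i+2b+1)(2i+2b+3)}\Bigg)\frac{\sqrt{\pi}\;\Gamma(b+1)}{2\,\Gamma\big(b+\frac52\big)}\;\delta_{n,m}.$$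
   Context: The monic generalized ultraspherical polynomials with parameters $u,v$ are $$\bar S_n(x)=\prod_{i=0}^{[n/2]-1}\frac{2i+2u+2-(-1)^n}{-2i-\big(2v+2u+2-(-1)^n+2[n/2]\big)}\;\sum_{k=0}^{[n/2]}\binom{[n/2]}{k}\Bigg(\prod_{i=0}^{[n/2]-(k+1)}\frac{-2i-\big(2v+2u+2-(-1)^n+2[n/2]\big)}{2i+2u+2-(-1)^n}\Bigg)x^{n-2k};$$ here they are taken with $u=1$, $v=b$. $[\cdot]$ is the integer part, empty products equal $1$, and $\delta_{n,m}$ is the Kronecker delta. The differential equation is considered for $x\in(-1,1)$, $x\ne0$. *)

theory Defs
  imports "HOL-Analysis.Analysis"
begin

definition gen_ultraspherical :: "real \<Rightarrow> real \<Rightarrow> nat \<Rightarrow> real \<Rightarrow> real" where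
  "gen_ultraspherical u v n x =
     (\<Prod>i<n div 2.
        (2 * real i + 2 * u + 2 - (-1) ^ n) /
        (- 2 * real i - (2 * v + 2 * u + 2 - (-1) ^ n + 2 * real (n div 2)))) *
     (\<Sum>k\<le>n div 2. real ((n div 2) choose k) *
        (\<Prod>i<n div 2 - k.
           (- 2 * real i - (2 * v + 2 * u + 2 - (-1) ^ n + 2 * real (n div 2))) /
           (2 * real i + 2 * u + 2 - (-1) ^ n)) *
        x ^ (n - 2 * k))"

text \<open>
  Only the values for \<open>-1 < x < 1\<close> are meaningful: at the endpoints \<open>0 powr (b/2) = 0\<close> in HOL
  for every \<open>b\<close>.
\<close>

definition Q :: "real \<Rightarrow> nat \<Rightarrow> real \<Rightarrow> real" where
  "Q b n x = x * (1 - x\<^sup>2) powr (b / 2) * gen_ultraspherical 1 b n x"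

end

theory Submission
  imports Defs
begin

text \<open>
  Consecutive coefficients of the monic polynomial \<open>S\<^sub>n\<close> have a simple rational ratio. Comparing
  coefficients gives both the second order equation for \<open>x S\<^sub>n(x)\<close>, which the factor
  \<open>(1 - x\<^sup>2)\<^bsup>b/2\<^esup>\<close> turns into the stated one, and the recurrence
  \<open>S\<^sub>n\<^sub>+\<^sub>1(x) = x S\<^sub>n(x) - \<gamma>\<^sub>n S\<^sub>n\<^sub>-\<^sub>1(x)\<close>, where \<open>\<gamma>\<^sub>i\<close> are the factors of the product in the
  norm formula. Let \<open>L\<close> be integration against \<open>x\<^sup>2 (1 - x\<^sup>2)\<^bsup>b\<^esup>\<close>. Its moments are Beta values, and
  \<open>L(S\<^sub>n)\<close> is then a telescoping sum, equal to \<open>0\<close> for \<open>n > 0\<close>. The recurrence, applied to both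
  factors, reduces \<open>L(S\<^sub>n S\<^sub>m)\<close> to \<open>L(S\<^sub>j)\<close>, which yields orthogonality and
  \<open>L(S\<^sub>n\<^sup>2) = \<gamma>\<^sub>1 \<cdots> \<gamma>\<^sub>n L(1)\<close>.
\<close>

subsection \<open>Coefficients and three-term recurrence\<close>

text \<open>The j-th factor is the ratio of consecutive coefficients of the monic polynomial.
  Keeping \<open>n mod 2\<close> symbolic lets one formula cover both parities.\<close>

definition gu_coeff :: "real \<Rightarrow> nat \<Rightarrow> nat \<Rightarrow> real" where
  "gu_coeff b n k = (\<Prod>j<k. - ((real n - real (n mod 2) - 2 * real j) * (real n + real (n mod 2) + 1 - 2 * real j)) /
     ((2 * real j + 2) * (2 * real n + 1 - 2 * real j + 2 * b)))"

definition gu_poly :: "real \<Rightarrow> nat \<Rightarrow> real \<Rightarrow> real" where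
  "gu_poly b n x = (\<Sum>k\<le>n div 2. gu_coeff b n k * x ^ (n - 2 * k))"

lemma gu_coeff_0 [simp]: "gu_coeff b n 0 = 1"
  by (simp add: gu_coeff_def)

lemma gu_coeff_Suc:
  "gu_coeff b n (Suc k) = gu_coeff b n k *
     (- ((real n - real (n mod 2) - 2 * real k) * (real n + real (n mod 2) + 1 - 2 * real k)) /
     ((2 * real k + 2) * (2 * real n + 1 - 2 * real k + 2 * b)))"
  by (simp add: gu_coeff_def)

text \<open>The factor at index \<open>n div 2\<close> vanishes, so sums over k can be extended past
  \<open>n div 2\<close> by zero terms.\<close>

lemma gu_coeff_eq_0: "n div 2 < k \<Longrightarrow> gu_coeff b n k = 0"
proof -
  assume "n div 2 < k"
  moreover have "real n - real (n mod 2) - 2 * real (n div 2) = 0"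
    using div_mult_mod_eq[of n 2] by linarith
  ultimately show ?thesis
    unfolding gu_coeff_def by (intro prod_zero bexI[of _ "n div 2"]) auto
qed

text \<open>Writing n = 2N + p, the prefactor cancels the inner product except for the indices
  \<open>N-k..<N\<close>. Raising k by one then brings in a single new factor, at
  \<open>N - Suc k\<close>, together with the binomial ratio (N - k) / (k + 1); their product is the
  ratio built into \<open>gu_coeff\<close>.\<close>

lemma gen_ultraspherical_eq_gu_poly:
  assumes b: "b > -1"
  shows "gen_ultraspherical 1 b n x = gu_poly b n x"
proof -
  define N where "N = n div 2"
  define p where "p = n mod 2"
  have n: "n = 2 * N + p" by (simp add: N_def p_def)
  have p: "p = 0 \<or> p = 1" by (auto simp: p_def)
  have sgn: "(-1::real) ^ n = 1 - 2 * real p"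
    using p by (auto simp: n)
  define \<alpha> where "\<alpha> i = 2 * real i + 2 * 1 + 2 - (-1) ^ n" for i
  define \<beta> where "\<beta> i = - 2 * real i - (2 * b + 2 * 1 + 2 - (-1) ^ n + 2 * real N)" for i
  \<comment> \<open>For u = 1 every \<alpha> is at least 3, and b > -1 keeps every \<beta> negative,
    so no quotient below hides a division by zero.\<close>
  have nz: "\<alpha> i \<noteq> 0" "\<beta> i \<noteq> 0" for i
    using p b by (auto simp: \<alpha>_def \<beta>_def sgn)
  have cancel: "(\<Prod>i<N. \<alpha> i / \<beta> i) * (\<Prod>i<N-k. \<beta> i / \<alpha> i) = (\<Prod>i=N-k..<N. \<alpha> i / \<beta> i)" if "k \<le> N" for k
  proof -
    have "(\<Prod>i<N. \<alpha> i / \<beta> i) = (\<Prod>i<N-k. \<alpha> i / \<beta> i) * (\<Prod>i=N-k..<N. \<alpha> i / \<beta> i)"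
      using prod.atLeastLessThan_concat[of 0 "N-k" N "\<lambda>i. \<alpha> i / \<beta> i"] by (simp add: atLeast0LessThan)
    moreover have "(\<Prod>i<N-k. \<alpha> i / \<beta> i) * (\<Prod>i<N-k. \<beta> i / \<alpha> i) = 1"
      by (simp add: nz flip: prod.distrib)
    ultimately show ?thesis by (simp add: mult_ac)
  qed
  have coeff: "real (N choose k) * (\<Prod>i=N-k..<N. \<alpha> i / \<beta> i) = gu_coeff b n k" if "k \<le> N" for k
    using that
  proof (induction k)
    case (Suc k)
    have split: "(\<Prod>i=N - Suc k..<N. \<alpha> i / \<beta> i) = \<alpha> (N - Suc k) / \<beta> (N - Suc k) * (\<Prod>i=N-k..<N. \<alpha> i / \<beta> i)"
      using Suc.prems by (subst prod.atLeast_Suc_lessThan) (auto simp: Suc_diff_Suc)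
    have "Suc k * (N choose Suc k) = (N - k) * (N choose k)"
      by (simp only: binomial_absorption binomial_absorb_comp)
    then have "real (Suc k) * real (N choose Suc k) = (real N - real k) * real (N choose k)"
      using Suc.prems by (metis Suc_leD of_nat_diff of_nat_mult)
    then have ch: "real (N choose Suc k) = real (N choose k) * ((real N - real k) / (real k + 1))"
      by (simp add: field_simps)
    have pos: "2 * real n + 1 - 2 * real k + 2 * b > 0"
      using Suc.prems b by (simp add: n)
    have r: "(real N - real k) / (real k + 1) * (\<alpha> (N - Suc k) / \<beta> (N - Suc k)) =
       - ((real n - real p - 2 * real k) * (real n + real p + 1 - 2 * real k)) /
     ((2 * real k + 2) * (2 * real n + 1 - 2 * real k + 2 * b))"
    proof -
      have a: "\<alpha> (N - Suc k) = real n + real p + 1 - 2 * real k"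
        using Suc.prems by (simp add: \<alpha>_def sgn of_nat_diff) (simp add: n)
      have b': "\<beta> (N - Suc k) = - (2 * real n + 1 - 2 * real k + 2 * b)"
        using Suc.prems by (simp add: \<beta>_def sgn of_nat_diff) (simp add: n)
      have c: "real n - real p - 2 * real k = 2 * (real N - real k)" by (simp add: n)
      show ?thesis unfolding a b' c using pos
        by (simp add: divide_simps) (simp add: algebra_simps)
    qed
    have "real (N choose Suc k) * (\<Prod>i=N - Suc k..<N. \<alpha> i / \<beta> i) =
      (real (N choose k) * (\<Prod>i=N-k..<N. \<alpha> i / \<beta> i)) * ((real N - real k) / (real k + 1) * (\<alpha> (N - Suc k) / \<beta> (N - Suc k)))"
      unfolding ch split by (simp add: mult_ac)
    also have "\<dots> = gu_coeff b n (Suc k)"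
      unfolding r gu_coeff_Suc p_def[symmetric] using Suc by simp
    finally show ?case .
  qed simp
  have "gen_ultraspherical 1 b n x = (\<Prod>i<N. \<alpha> i / \<beta> i) *
      (\<Sum>k\<le>N. real (N choose k) * (\<Prod>i<N-k. \<beta> i / \<alpha> i) * x ^ (n - 2 * k))"
    by (simp only: gen_ultraspherical_def \<alpha>_def \<beta>_def N_def)
  also have "\<dots> = (\<Sum>k\<le>N. real (N choose k) * ((\<Prod>i<N. \<alpha> i / \<beta> i) * (\<Prod>i<N-k. \<beta> i / \<alpha> i)) * x ^ (n - 2 * k))"
    by (simp add: sum_distrib_left mult_ac)
  also have "\<dots> = (\<Sum>k\<le>N. gu_coeff b n k * x ^ (n - 2 * k))"
    by (intro sum.cong refl) (simp add: cancel coeff flip: mult.assoc)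
  finally show ?thesis by (simp add: gu_poly_def N_def)
qed

section \<open>Coefficients of neighbouring degrees and the recurrence\<close>

definition gu_rec :: "real \<Rightarrow> nat \<Rightarrow> real" where
  "gu_rec b i = (real i + 1 - (-1) ^ i) * (real i + 1 - (-1) ^ i + 2 * b) /
                 ((2 * real i + 2 * b + 1) * (2 * real i + 2 * b + 3))"

text \<open>Both coefficients are products of known ratios, so induction on k compares just one
  factor on each side. The bound \<open>2 * k \<le> m\<close> keeps the denominators positive; the
  parity cases arise because m and m + 1 differ modulo 2.\<close>

lemma gu_coeff_Suc_n:
  assumes b: "b > -1" and "2 * k \<le> m"
  shows "gu_coeff b (Suc m) (Suc k) * ((2 * real k + 2) * (2 * real m + 2 * b + 3)) =
      - (if even m then (real m - 2 * real k) * (real m + 3) else (real m + 1) * (real m + 2 - 2 * real k))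
      * gu_coeff b m k"
  using assms(2)
proof (induction k)
  case 0
  show ?case using b by (simp add: gu_coeff_Suc mod2_eq_if field_simps)
next
  case (Suc k)
  define X where "X = gu_coeff b (Suc m) (Suc k)"
  define Y where "Y = gu_coeff b m k"
  have ih: "X = - (if even m then (real m - 2 * real k) * (real m + 3) else (real m + 1) * (real m + 2 - 2 * real k))
      * Y / ((2 * real k + 2) * (2 * real m + 2 * b + 3))"
    using Suc b unfolding X_def Y_def by (subst eq_divide_eq) simp
  have k: "real m \<ge> 2 * real k + 2" using of_nat_mono[OF Suc.prems, where 'a = real] by simp
  have pos: "2 * real m + 2 * b + 3 > 0" "2 * real m + 1 - 2 * real k + 2 * b > 0" using k b by linarith+
  show ?case
    unfolding gu_coeff_Suc[of b "Suc m" "Suc k"] gu_coeff_Suc[of b m k] X_def[symmetric] Y_def[symmetric] ih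
    using pos by (simp add: mod2_eq_if divide_simps) (auto simp: algebra_simps)
qed

text \<open>Two degrees up the parity is the same, and the denominators 2n + 1 - 2j + 2b are those
  of degree m shifted by two indices. Almost all of them cancel, leaving the two leading ones and
  the factor 2m + 3 - 2k + 2b.\<close>

lemma gu_coeff_Suc_Suc_n:
  assumes b: "b > -1" and "2 * k \<le> m"
  shows "gu_coeff b (Suc (Suc m)) (Suc k) * ((2 * real k + 2) * (2 * real m + 2 * b + 3) * (2 * real m + 2 * b + 5)) =
      - (if even m then (real m + 2) * (real m + 3) else (real m + 1) * (real m + 4))
      * (2 * real m + 3 - 2 * real k + 2 * b) * gu_coeff b m k"
  using assms(2)
proof (induction k)
  case 0
  show ?case using b by (simp add: gu_coeff_Suc mod2_eq_if field_simps)
next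
  case (Suc k)
  define X where "X = gu_coeff b (Suc (Suc m)) (Suc k)"
  define Y where "Y = gu_coeff b m k"
  have ih: "X = - (if even m then (real m + 2) * (real m + 3) else (real m + 1) * (real m + 4))
      * (2 * real m + 3 - 2 * real k + 2 * b) * Y / ((2 * real k + 2) * (2 * real m + 2 * b + 3) * (2 * real m + 2 * b + 5))"
    using Suc b unfolding X_def Y_def by (subst eq_divide_eq) simp
  have k: "real m \<ge> 2 * real k + 2" using of_nat_mono[OF Suc.prems, where 'a = real] by simp
  have pos: "2 * real m + 2 * b + 3 > 0" "2 * real m + 2 * b + 5 > 0"
     "2 * real m + 1 - 2 * real k + 2 * b > 0" "2 * real m + 3 - 2 * real k + 2 * b > 0" using k b by linarith+
  show ?case
    unfolding gu_coeff_Suc[of b "Suc (Suc m)" "Suc k"] gu_coeff_Suc[of b m k] X_def[symmetric] Y_def[symmetric] ih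
    using pos by (simp add: mod2_eq_if divide_simps) (auto simp: algebra_simps)
qed

text \<open>Over the common denominator \<open>D\<close>, the two preceding lemmas turn every term
  into a polynomial multiple of \<open>gu_coeff b m k\<close>, so that a polynomial identity for
  each parity remains.\<close>

lemma gu_coeff_rec:
  assumes b: "b > -1" and "2 * k \<le> m"
  shows "gu_coeff b (Suc (Suc m)) (Suc k) =
      gu_coeff b (Suc m) (Suc k) - gu_rec b (Suc m) * gu_coeff b m k"
proof -
  have pos: "2 * real m + 2 * b + 3 > 0" "2 * real m + 2 * b + 5 > 0" using b by linarith+
  define D where "D = (2 * real k + 2) * (2 * real m + 2 * b + 3) * (2 * real m + 2 * b + 5)"
  have D: "D \<noteq> 0" unfolding D_def using pos by simp
  have 1: "gu_coeff b (Suc m) (Suc k) * D =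
     - (if even m then (real m - 2 * real k) * (real m + 3) else (real m + 1) * (real m + 2 - 2 * real k))
      * gu_coeff b m k * (2 * real m + 2 * b + 5)"
    unfolding D_def gu_coeff_Suc_n[OF assms, symmetric] by (simp only: mult_ac)
  have 2: "gu_rec b (Suc m) * D = (2 * real k + 2) *
     (if even m then (real m + 3) * (real m + 3 + 2 * b) else (real m + 1) * (real m + 1 + 2 * b))"
    unfolding D_def gu_rec_def using pos by (simp add: add_ac)
  have "(gu_coeff b (Suc m) (Suc k) - gu_rec b (Suc m) * gu_coeff b m k) * D =
     gu_coeff b (Suc m) (Suc k) * D - (gu_rec b (Suc m) * D) * gu_coeff b m k"
    by (simp add: algebra_simps)
  also have "\<dots> = gu_coeff b (Suc (Suc m)) (Suc k) * D"
    unfolding 1 2 gu_coeff_Suc_Suc_n[OF assms, folded D_def] by (simp add: algebra_simps)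
  finally show ?thesis using D by simp
qed

lemma gu_poly_0: "gu_poly b 0 x = 1"
  by (simp add: gu_poly_def)

lemma gu_poly_1: "gu_poly b (Suc 0) x = x"
  by (simp add: gu_poly_def)

lemma gu_poly_rec:
  assumes b: "b > -1"
  shows "gu_poly b (Suc (Suc m)) x = x * gu_poly b (Suc m) x - gu_rec b (Suc m) * gu_poly b m x"
proof -
  define M where "M = m div 2"
  have "x * gu_poly b (Suc m) x = (\<Sum>k\<le>Suc m div 2. gu_coeff b (Suc m) k * x ^ (Suc (Suc m) - 2 * k))"
    unfolding gu_poly_def sum_distrib_left
    by (intro sum.cong refl) (auto simp: Suc_diff_le simp flip: power_Suc)
  \<comment> \<open>For even m the index \<open>Suc M\<close> is new and its coefficient is zero;
    for odd m the range is unchanged.\<close>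
  also have "\<dots> = (\<Sum>k\<le>Suc M. gu_coeff b (Suc m) k * x ^ (Suc (Suc m) - 2 * k))"
    by (intro sum.mono_neutral_left) (auto simp: M_def gu_coeff_eq_0)
  also have "\<dots> = x ^ Suc (Suc m) + (\<Sum>k\<le>M. gu_coeff b (Suc m) (Suc k) * x ^ (m - 2 * k))"
    by (subst sum.atMost_Suc_shift) simp
  finally have 1: "x * gu_poly b (Suc m) x = \<dots>" .
  have 2: "gu_poly b (Suc (Suc m)) x = x ^ Suc (Suc m) + (\<Sum>k\<le>M. gu_coeff b (Suc (Suc m)) (Suc k) * x ^ (m - 2 * k))"
    unfolding gu_poly_def M_def by (simp add: sum.atMost_Suc_shift del: sum.atMost_Suc)
  have "(\<Sum>k\<le>M. gu_coeff b (Suc (Suc m)) (Suc k) * x ^ (m - 2 * k)) =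
     (\<Sum>k\<le>M. gu_coeff b (Suc m) (Suc k) * x ^ (m - 2 * k) - gu_rec b (Suc m) * (gu_coeff b m k * x ^ (m - 2 * k)))"
    by (intro sum.cong refl) (simp add: M_def gu_coeff_rec[OF b] algebra_simps)
  then show ?thesis
    unfolding 1 2 by (simp add: gu_poly_def M_def sum_subtractf sum_distrib_left)
qed

subsection \<open>Orthogonality\<close>

text \<open>Substitution t = x^2 in the Beta integral; dt = 2x dx accounts for the factor
  1/2.\<close>

lemma has_integral_even_power_weight_01:
  assumes b: "b > -1"
  shows "((\<lambda>x::real. x ^ (2 * j) * (1 - x\<^sup>2) powr b) has_integral Beta (real j + 1/2) (b + 1) / 2) {0<..<1}"
proof -
  define f where "f = (\<lambda>t::real. t powr (real j + 1/2 - 1) * (1 - t) powr (b + 1 - 1))"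
  have img: "(\<lambda>x::real. x\<^sup>2) ` {0<..<1} = {0<..<1}"
  proof (intro equalityI subsetI)
    fix y :: real assume y: "y \<in> {0<..<1}"
    then have "sqrt y \<in> {0<..<1}" "y = (sqrt y)\<^sup>2" by auto
    then show "y \<in> (\<lambda>x. x\<^sup>2) ` {0<..<1}" by blast
  next
    fix y :: real assume "y \<in> (\<lambda>x. x\<^sup>2) ` {0<..<1}"
    then show "y \<in> {0<..<1}" by (auto simp: power_less_one_iff abs_square_less_1)
  qed
  have inj: "inj_on (\<lambda>x::real. x\<^sup>2) {0<..<1}"
    by (rule inj_onI) (simp add: power2_eq_iff_nonneg)
  have hi: "(f has_integral Beta (real j + 1/2) (b + 1)) {0<..<1}"
    unfolding f_def using has_integral_Beta_real[of "real j + 1/2" "b + 1"] b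
    by (simp add: has_integral_Icc_iff_Ioo)
  have "f absolutely_integrable_on {0<..<1}"
    using hi by (intro nonnegative_absolutely_integrable_1) (auto simp: f_def)
  then have "f absolutely_integrable_on (\<lambda>x. x\<^sup>2) ` {0<..<1} \<and> integral ((\<lambda>x. x\<^sup>2) ` {0<..<1}) f = Beta (real j + 1/2) (b + 1)"
    using hi by (simp add: img integral_unique)
  then have "(\<lambda>x. \<bar>2 * x\<bar> * f (x\<^sup>2)) absolutely_integrable_on {0<..<1} \<and>
      integral {0<..<1} (\<lambda>x. \<bar>2 * x\<bar> * f (x\<^sup>2)) = Beta (real j + 1/2) (b + 1)"
    by (subst has_absolute_integral_change_of_variables_1'[where g = "\<lambda>x. x\<^sup>2"])
      (auto simp: inj intro!: derivative_eq_intros)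
  then have "((\<lambda>x. \<bar>2 * x\<bar> * f (x\<^sup>2)) has_integral Beta (real j + 1/2) (b + 1)) {0<..<1}"
    using set_lebesgue_integral_eq_integral(1) by (metis has_integral_integral)
  then have "((\<lambda>x. (1/2) * (\<bar>2 * x\<bar> * f (x\<^sup>2))) has_integral (1/2) * Beta (real j + 1/2) (b + 1)) {0<..<1}"
    by (rule has_integral_mult_right)
  moreover have "(1/2) * (\<bar>2 * x\<bar> * f (x\<^sup>2)) = x ^ (2 * j) * (1 - x\<^sup>2) powr b" if "x \<in> {0<..<1}" for x
  proof -
    have "x * (x\<^sup>2) powr (real j + 1/2 - 1) = x powr (1 + 2 * (real j + 1/2 - 1))"
      using that by (simp add: powr_mult_base powr_powr flip: powr_numeral)
    also have "\<dots> = x powr real (2 * j)" by (simp add: algebra_simps)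
    also have "\<dots> = x ^ (2 * j)" using that by (subst powr_realpow) auto
    finally show ?thesis using that by (simp add: f_def)
  qed
  ultimately show ?thesis
    by (subst has_integral_cong[where g = "\<lambda>x. (1/2) * (\<bar>2 * x\<bar> * f (x\<^sup>2))"]) auto
qed

lemma has_integral_even_power_weight:
  assumes b: "b > -1"
  shows "((\<lambda>x::real. x ^ (2 * j) * (1 - x\<^sup>2) powr b) has_integral Beta (real j + 1/2) (b + 1)) {-1<..<1}"
proof -
  let ?f = "\<lambda>x::real. x ^ (2 * j) * (1 - x\<^sup>2) powr b"
  have 1: "(?f has_integral Beta (real j + 1/2) (b + 1) / 2) {0..1}"
    using has_integral_even_power_weight_01[OF b] by (simp add: has_integral_Icc_iff_Ioo)
  then have "((\<lambda>x. ?f (- x)) has_integral Beta (real j + 1/2) (b + 1) / 2) {-1..-0}"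
    by (subst has_integral_reflect_real)
  then have 2: "(?f has_integral Beta (real j + 1/2) (b + 1) / 2) {-1..0}"
    by (simp add: power_mult)
  show ?thesis
    using has_integral_combine[OF _ _ 2 1] by (simp add: has_integral_Icc_iff_Ioo)
qed

text \<open>Nonnegativity upgrades gauge integrability to absolute integrability; Borel
  measurability then allows the passage from the completed measure to \<open>lborel\<close>.\<close>

lemma set_integrable_even_power_weight:
  assumes b: "b > -1"
  shows "set_integrable lborel {-1<..<1} (\<lambda>x::real. x ^ (2 * j) * (1 - x\<^sup>2) powr b)"
proof -
  have "(\<lambda>x::real. x ^ (2 * j) * (1 - x\<^sup>2) powr b) absolutely_integrable_on {-1<..<1}"
    using has_integral_even_power_weight[OF b, of j]
    by (intro nonnegative_absolutely_integrable_1) (auto simp: power_mult)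
  then show ?thesis
    unfolding set_integrable_def by (subst (asm) integrable_completion) auto
qed

text \<open>A continuous g is bounded on the compact interval [-1, 1], so a constant multiple of the
  weight dominates the integrand.\<close>

lemma set_integrable_weight:
  fixes g :: "real \<Rightarrow> real"
  assumes b: "b > -1" and g: "continuous_on UNIV g"
  shows "set_integrable lborel {-1<..<1} (\<lambda>x. g x * (1 - x\<^sup>2) powr b)"
proof -
  have "compact (g ` {-1..1})"
    using g by (intro compact_continuous_image) (auto intro: continuous_on_subset)
  then have "bounded (g ` {-1..1})"
    by (rule compact_imp_bounded)
  then obtain C where C: "\<And>x. x \<in> {-1..1} \<Longrightarrow> \<bar>g x\<bar> \<le> C"
    by (metis bounded_iff imageI real_norm_def)
  have [measurable]: "g \<in> borel_measurable borel"
    using g by (rule borel_measurable_continuous_onI)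
  have "set_integrable lborel {-1<..<1} (\<lambda>x. C * (x ^ (2 * 0) * (1 - x\<^sup>2) powr b))"
    by (intro set_integrable_mult_right set_integrable_even_power_weight b)
  then show ?thesis
  proof (rule set_integrable_bound)
    show "set_borel_measurable lborel {-1<..<1} (\<lambda>x. g x * (1 - x\<^sup>2) powr b)"
      unfolding set_borel_measurable_def by measurable
    have "norm (g x * (1 - x\<^sup>2) powr b) \<le> norm (C * (x ^ (2 * 0) * (1 - x\<^sup>2) powr b))"
      if "x \<in> {-1<..<1}" for x
      using C[of x] that by (auto simp: abs_mult intro!: mult_right_mono)
    then show "AE x in lborel. x \<in> {-1<..<1} \<longrightarrow>
       norm (g x * (1 - x\<^sup>2) powr b) \<le> norm (C * (x ^ (2 * 0) * (1 - x\<^sup>2) powr b))"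
      by simp
  qed
qed

section \<open>The weighted integral functional and its moments\<close>

definition gu_int :: "real \<Rightarrow> (real \<Rightarrow> real) \<Rightarrow> real" where
  "gu_int b g = (LBINT x:{-1<..<1}. g x * x\<^sup>2 * (1 - x\<^sup>2) powr b)"

lemma gu_integrable:
  fixes g :: "real \<Rightarrow> real"
  assumes b: "b > -1" and g: "continuous_on UNIV g"
  shows "set_integrable lborel {-1<..<1} (\<lambda>x. g x * x\<^sup>2 * (1 - x\<^sup>2) powr b)"
  by (intro set_integrable_weight[OF b] continuous_intros g)

text \<open>Continuity supplies integrability of both summands; a non-integrable function has
  integral 0 by default, which would break additivity.\<close>

lemma gu_int_add:
  assumes "b > -1" "continuous_on UNIV f" "continuous_on UNIV g"
  shows "gu_int b (\<lambda>x. f x + g x) = gu_int b f + gu_int b g"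
  using gu_integrable[OF assms(1,2)] gu_integrable[OF assms(1,3)]
  by (simp add: gu_int_def ring_distribs set_integral_add)

lemma gu_int_cmult: "gu_int b (\<lambda>x. c * f x) = c * gu_int b f"
  by (simp add: gu_int_def mult.assoc)

lemma gu_int_diff_cmult:
  assumes "b > -1" "continuous_on UNIV f" "continuous_on UNIV g"
  shows "gu_int b (\<lambda>x. f x - c * g x) = gu_int b f - c * gu_int b g"
  using gu_int_add[of b f "\<lambda>x. - c * g x"] gu_int_cmult[of b "-c" g] assms
  by (simp add: continuous_intros)

lemma gu_int_sum:
  assumes "b > -1" "\<And>i. i \<in> A \<Longrightarrow> continuous_on UNIV (f i)" "finite A"
  shows "gu_int b (\<lambda>x. \<Sum>i\<in>A. f i x) = (\<Sum>i\<in>A. gu_int b (f i))"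
  using assms(3,2)
proof (induction A)
  case (insert a A)
  then show ?case
    by (simp add: gu_int_add[OF assms(1)] continuous_on_sum)
qed (simp add: gu_int_def)

lemma gu_int_odd_power: "odd m \<Longrightarrow> gu_int b (\<lambda>x. x ^ m) = 0"
proof -
  assume m: "odd m"
  have "gu_int b (\<lambda>x. x ^ m) = (LBINT x:{x. - x \<in> {-1<..<1}}. (- x) ^ m * (- x)\<^sup>2 * (1 - (- x)\<^sup>2) powr b)"
    unfolding gu_int_def by (rule set_integral_reflect)
  also have "{x::real. - x \<in> {-1<..<1}} = {-1<..<1}" by auto
  also have "(LBINT x:{-1<..<1}. (- x) ^ m * (- x)\<^sup>2 * (1 - (- x)\<^sup>2) powr b) = - gu_int b (\<lambda>x. x ^ m)"
    using m by (simp add: gu_int_def set_lebesgue_integral_def)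
  finally show ?thesis by simp
qed

lemma gu_int_even_power:
  assumes "b > -1"
  shows "gu_int b (\<lambda>x. x ^ (2 * j)) = Beta (real j + 3/2) (b + 1)"
proof -
  have "gu_int b (\<lambda>x. x ^ (2 * j)) = (LBINT x:{-1<..<1}. x ^ (2 * Suc j) * (1 - x\<^sup>2) powr b)"
    unfolding gu_int_def by (simp add: power2_eq_square mult_ac)
  also have "\<dots> = integral {-1<..<1} (\<lambda>x. x ^ (2 * Suc j) * (1 - x\<^sup>2) powr b)"
    by (intro set_borel_integral_eq_integral set_integrable_even_power_weight assms)
  also have "\<dots> = Beta (real (Suc j) + 1/2) (b + 1)"
    by (intro integral_unique has_integral_even_power_weight assms)
  finally show ?thesis by (simp add: algebra_simps)
qed

text \<open>For even m this is twice the functional equation of \<open>Beta\<close> in its first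
  argument; for odd m both moments are zero.\<close>

lemma gu_int_power_Suc:
  assumes b: "b > -1"
  shows "(real m + 5 + 2 * b) * gu_int b (\<lambda>x. x ^ (m + 2)) = (real m + 3) * gu_int b (\<lambda>x. x ^ m)"
proof (cases "even m")
  case True
  then obtain j where m: "m = 2 * j" by blast
  have "(real j + 3/2 + (b + 1)) * Beta (real j + 3/2 + 1) (b + 1) = (real j + 3/2) * Beta (real j + 3/2) (b + 1)"
    by (intro Beta_plus1_left) auto
  moreover have "m + 2 = 2 * Suc j" by (simp add: m)
  ultimately show ?thesis
    unfolding m \<open>m + 2 = 2 * Suc j\<close>[unfolded m] gu_int_even_power[OF b] by (simp add: algebra_simps)
next
  case False
  then show ?thesis by (simp add: gu_int_odd_power del: power_Suc add_2_eq_Suc')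
qed

lemma gu_int_1:
  assumes "b > -1"
  shows "gu_int b (\<lambda>x. 1) = sqrt pi * Gamma (b + 1) / (2 * Gamma (b + 5/2))"
proof -
  have "sqrt pi = Gamma (3/2 :: real) * 2"
    using Gamma_plus1[of "1/2 :: real"] nonpos_Ints_nonpos[of "1/2 :: real"]
    by (force simp: Gamma_one_half_real)
  moreover have "gu_int b (\<lambda>x. 1) = Gamma (3/2) * Gamma (b + 1) / Gamma (b + 5/2)"
    using gu_int_even_power[OF assms, of 0] by (simp add: Beta_def add.commute)
  ultimately show ?thesis by simp
qed

section \<open>Orthogonality and norms of the polynomials\<close>

lemma continuous_gu_poly [continuous_intros]: "continuous_on A (gu_poly b n)"
  unfolding gu_poly_def by (intro continuous_intros)

text \<open>Orthogonality to constants, the base of the later induction. For odd n every moment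
  involved vanishes; for even n the ratios of coefficients and of moments make the sum
  telescope.\<close>

lemma gu_int_gu_poly:
  assumes b: "b > -1" and n: "n > 0"
  shows "gu_int b (gu_poly b n) = 0"
proof (cases "even n")
  case True
  define N where "N = n div 2"
  have n2: "n = 2 * N" using True by (simp add: N_def)
  define \<mu> where "\<mu> k = gu_int b (\<lambda>x. x ^ (n - 2 * k))" for k
  \<comment> \<open>Gosper's closed form of the partial sums of
    \<open>\<^sub>2F\<^sub>1(-N, b + N + 3/2; b + 5/2; 1)\<close>, summed from the top index downwards\<close>
  have partial: "real n * (real n + 2 * b + 3) * (\<Sum>k\<le>K. gu_coeff b n k * \<mu> k) =
      gu_coeff b n K * \<mu> K * (real n - 2 * real K) * (real n - 2 * real K + 2 * b + 3)" if "K \<le> N" for K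
    using that
  proof (induction K)
    case (Suc K)
    have mm: "n - 2 * K = n - 2 * Suc K + 2" using Suc.prems by (simp add: n2)
    have mom: "(real n - 2 * real K + 3 + 2 * b) * \<mu> K = (real n - 2 * real K + 1) * \<mu> (Suc K)"
      using gu_int_power_Suc[OF b, of "n - 2 * Suc K"] Suc.prems unfolding \<mu>_def mm
      by (simp add: n2 of_nat_diff algebra_simps)
    have K: "real n \<ge> 2 * real K + 2" using Suc.prems n2 by simp
    then have pos: "2 * real n + 1 - 2 * real K + 2 * b > 0" using b by linarith
    have co: "gu_coeff b n K * ((real n - 2 * real K) * (real n + 1 - 2 * real K)) =
        - gu_coeff b n (Suc K) * ((2 * real K + 2) * (2 * real n + 1 - 2 * real K + 2 * b))"
      using pos True by (simp add: gu_coeff_Suc mod2_eq_if)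
    have "real n * (real n + 2 * b + 3) * (\<Sum>k\<le>Suc K. gu_coeff b n k * \<mu> k) =
      gu_coeff b n K * (real n - 2 * real K) * ((real n - 2 * real K + 3 + 2 * b) * \<mu> K)
      + real n * (real n + 2 * b + 3) * gu_coeff b n (Suc K) * \<mu> (Suc K)"
      using Suc by (simp add: algebra_simps)
    also have "\<dots> = (gu_coeff b n K * ((real n - 2 * real K) * (real n + 1 - 2 * real K))) * \<mu> (Suc K)
      + real n * (real n + 2 * b + 3) * gu_coeff b n (Suc K) * \<mu> (Suc K)"
      unfolding mom by (simp add: mult_ac add_ac)
    \<comment> \<open>Rests on n(n + 2b + 3) - (2K + 2)(2n + 1 - 2K + 2b) = (n - 2K - 2)(n - 2K + 2b
      + 1).\<close>
    also have "\<dots> = gu_coeff b n (Suc K) * \<mu> (Suc K) * (real n - 2 * real (Suc K)) * (real n - 2 * real (Suc K) + 2 * b + 3)"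
      unfolding co by (simp add: algebra_simps)
    finally show ?case .
  qed simp
  \<comment> \<open>At K = N the closed form contains the factor n - 2N = 0, while n(n + 2b + 3) is
    positive.\<close>
  have "real n * (real n + 2 * b + 3) * (\<Sum>k\<le>N. gu_coeff b n k * \<mu> k) = 0"
    using partial[of N] by (simp add: n2)
  then have "(\<Sum>k\<le>N. gu_coeff b n k * \<mu> k) = 0" using b n by auto
  moreover have "gu_int b (gu_poly b n) = (\<Sum>k\<le>N. gu_coeff b n k * \<mu> k)"
    unfolding gu_poly_def[abs_def] N_def \<mu>_def
    by (subst gu_int_sum[OF b]) (auto intro!: continuous_intros simp: gu_int_cmult)
  ultimately show ?thesis by simp
next
  case False
  then have "gu_int b (\<lambda>x. x ^ (n - 2 * k)) = 0" if "k \<le> n div 2" for k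
    using that by (intro gu_int_odd_power) auto
  then show ?thesis
    unfolding gu_poly_def[abs_def]
    by (subst gu_int_sum[OF b]) (auto intro!: continuous_intros simp: gu_int_cmult)
qed

text \<open>Makes the backward term of the recurrence vanish at n = 0, where \<open>n - 1\<close> is
  truncated to 0.\<close>

lemma gu_rec_0: "gu_rec b 0 = 0"
  by (simp add: gu_rec_def)

text \<open>Strong induction on m with n arbitrary: the recurrence lowers m at the cost of a factor
  x, and the same recurrence read backwards lets the other polynomial absorb that x, moving n up or
  down by one.\<close>

lemma gu_int_gu_poly_mult:
  assumes b: "b > -1"
  shows "gu_int b (\<lambda>x. gu_poly b n x * gu_poly b m x) =
    (if n = m then (\<Prod>i=1..n. gu_rec b i) * gu_int b (\<lambda>x. 1) else 0)"
proof (induction m arbitrary: n rule: less_induct)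
  case (less m)
  define I where "I n m = gu_int b (\<lambda>x. gu_poly b n x * gu_poly b m x)" for n m
  define h where "h n = (\<Prod>i=1..n. gu_rec b i) * gu_int b (\<lambda>x. 1)" for n
  have h_Suc: "h (Suc n) = gu_rec b (Suc n) * h n" for n
    by (simp add: h_def)
  have x_mult: "gu_int b (\<lambda>x. x * gu_poly b n x * gu_poly b j x) = I (Suc n) j + gu_rec b n * I (n - 1) j" for n j
  proof (cases n)
    case 0
    then show ?thesis by (simp add: I_def gu_rec_0 gu_poly_0 gu_poly_1)
  next
    case (Suc k)
    have "gu_int b (\<lambda>x. x * gu_poly b n x * gu_poly b j x) =
       gu_int b (\<lambda>x. gu_poly b (Suc n) x * gu_poly b j x - (- gu_rec b n) * (gu_poly b (n - 1) x * gu_poly b j x))"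
      by (simp add: Suc gu_poly_rec[OF b] algebra_simps)
    also have "\<dots> = I (Suc n) j + gu_rec b n * I (n - 1) j"
      unfolding I_def by (subst gu_int_diff_cmult[OF b]) (auto intro!: continuous_intros)
    finally show ?thesis .
  qed
  have "I n m = (if n = m then h n else 0)"
  proof (cases m)
    case 0
    then show ?thesis
      using gu_int_gu_poly[OF b, of n] by (cases "n = 0") (auto simp: I_def h_def gu_poly_0)
  next
    case m: (Suc m')
    have IH: "I n j = (if n = j then h n else 0)" if "j < m" for n j
      using less.IH[OF that, of n] by (simp add: I_def h_def)
    show ?thesis
    proof (cases m')
      \<comment> \<open>Here m = 1, which the recurrence does not reach because it starts at degree
        2; the polynomial is x itself.\<close>
      case 0
      have "I n m = gu_int b (\<lambda>x. x * gu_poly b n x * gu_poly b 0 x)"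
        by (simp add: I_def m 0 gu_poly_0 gu_poly_1 mult.commute)
      also have "\<dots> = I (Suc n) 0 + gu_rec b n * I (n - 1) 0"
        by (rule x_mult)
      also have "\<dots> = (if n = m then h n else 0)"
        using m by (cases n) (auto simp: IH gu_rec_0 0 h_Suc)
      finally show ?thesis .
    next
      case m': (Suc k)
      have "I n m = gu_int b (\<lambda>x. x * gu_poly b n x * gu_poly b m' x - gu_rec b m' * (gu_poly b n x * gu_poly b k x))"
        by (simp add: I_def m m' gu_poly_rec[OF b] algebra_simps)
      also have "\<dots> = gu_int b (\<lambda>x. x * gu_poly b n x * gu_poly b m' x) - gu_rec b m' * I n k"
        unfolding I_def by (subst gu_int_diff_cmult[OF b]) (auto intro!: continuous_intros)
      also have "\<dots> = I (Suc n) m' + gu_rec b n * I (n - 1) m' - gu_rec b m' * I n k"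
        by (simp only: x_mult)
      \<comment> \<open>For n = m only the middle term survives and gives \<open>h n\<close>; for n
        = k the first and last terms cancel by \<open>h_Suc\<close>; otherwise all three
        vanish.\<close>
      also have "\<dots> = (if n = m then h n else 0)"
        using m m' by (cases n) (auto simp: IH gu_rec_0 h_Suc)
      finally show ?thesis .
    qed
  qed
  then show ?case by (simp add: I_def h_def)
qed

lemma Q_mult_eq:
  assumes "b > -1" "x \<in> {-1<..<1}"
  shows "Q b n x * Q b m x = gu_poly b n x * gu_poly b m x * x\<^sup>2 * (1 - x\<^sup>2) powr b"
proof -
  have "(1 - x\<^sup>2) powr (b / 2) * (1 - x\<^sup>2) powr (b / 2) = (1 - x\<^sup>2) powr b"
    by (simp flip: powr_add)
  then show ?thesis
    unfolding Q_def gen_ultraspherical_eq_gu_poly[OF assms(1)] by (simp add: power2_eq_square mult_ac)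
qed

lemma Q_orthogonal:
  assumes b: "b > -1"
  shows "set_integrable lborel {-1<..<1} (\<lambda>x. Q b n x * Q b m x)"
    and "(LBINT x:{-1<..<1}. Q b n x * Q b m x) =
           (\<Prod>i=1..n. gu_rec b i) * (sqrt pi * Gamma (b + 1) / (2 * Gamma (b + 5 / 2))) * (if n = m then 1 else 0)"
proof -
  have "set_integrable lborel {-1<..<1} (\<lambda>x. gu_poly b n x * gu_poly b m x * x\<^sup>2 * (1 - x\<^sup>2) powr b)"
    by (intro gu_integrable b continuous_intros)
  then show "set_integrable lborel {-1<..<1} (\<lambda>x. Q b n x * Q b m x)"
    by (subst set_integrable_cong[OF refl refl]) (auto simp: Q_mult_eq[OF b])
  have "(LBINT x:{-1<..<1}. Q b n x * Q b m x) = gu_int b (\<lambda>x. gu_poly b n x * gu_poly b m x)"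
    unfolding gu_int_def by (intro set_lebesgue_integral_cong) (auto simp: Q_mult_eq[OF b])
  then show "(LBINT x:{-1<..<1}. Q b n x * Q b m x) =
           (\<Prod>i=1..n. gu_rec b i) * (sqrt pi * Gamma (b + 1) / (2 * Gamma (b + 5 / 2))) * (if n = m then 1 else 0)"
    by (simp add: gu_int_gu_poly_mult[OF b] gu_int_1[OF b])
qed

subsection \<open>Differential equation\<close>

lemma gu_poly_ode:
  fixes b :: real and n :: nat
  defines "G \<equiv> \<lambda>x. x * gu_poly b n x" and "p \<equiv> real (n mod 2)"
  assumes b: "b > -1"
  obtains G1 G2 where
    "\<And>x. (G has_real_derivative G1 x) (at x)"
    "\<And>x. (G1 has_real_derivative G2 x) (at x)"
    "\<And>x. x\<^sup>2 * (1 - x\<^sup>2) * G2 x - 2 * (b + 1) * x ^ 3 * G1 x +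
         (((real n + b + 1) * (real n + b + 2) - b\<^sup>2 - b) * x\<^sup>2 - p * (p + 1)) * G x = 0"
proof -
  define G1 where "G1 x = (\<Sum>k\<le>n div 2. gu_coeff b n k * (real (n + 1 - 2 * k) * x ^ (n - 2 * k)))" for x
  define G2 where "G2 x = (\<Sum>k\<le>n div 2. gu_coeff b n k * (real (n + 1 - 2 * k) * (real (n - 2 * k) * x ^ (n - 2 * k - 1))))" for x
  define N where "N = n div 2"
  have G: "G = (\<lambda>x. \<Sum>k\<le>N. gu_coeff b n k * x ^ (n + 1 - 2 * k))"
    unfolding G_def gu_poly_def sum_distrib_left N_def
    by (intro ext sum.cong refl) (auto simp: Suc_diff_le)
  have dG: "(G has_real_derivative G1 x) (at x)" for x
    unfolding G G1_def N_def
    by (rule derivative_eq_intros refl | simp add: mult_ac)+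
  have dG1: "(G1 has_real_derivative G2 x) (at x)" for x
    unfolding G1_def[abs_def] G2_def
    by (rule derivative_eq_intros refl | simp add: mult_ac)+
  define \<Lambda> where "\<Lambda> = (real n + b + 1) * (real n + b + 2) - b\<^sup>2 - b"
  define B where "B k = (real n - p - 2 * real k) * (real n + p + 1 - 2 * real k)" for k
  define A where "A k = 2 * real k * (2 * real n + 3 - 2 * real k + 2 * b)" for k
  have summand: "x\<^sup>2 * (1 - x\<^sup>2) * (real (n + 1 - 2 * k) * (real (n - 2 * k) * x ^ (n - 2 * k - 1)))
      - 2 * (b + 1) * x ^ 3 * (real (n + 1 - 2 * k) * x ^ (n - 2 * k)) + (\<Lambda> * x\<^sup>2 - p * (p + 1)) * x ^ (n + 1 - 2 * k)
      = B k * x ^ (n + 1 - 2 * k) + A k * x ^ (n + 3 - 2 * k)" if "k \<le> N" for k x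
  proof -
    define q where "q = n - 2 * k"
    have q: "n = q + 2 * k" using that unfolding q_def N_def by linarith
    have e: "n + 1 - 2 * k = q + 1" "n - 2 * k = q" "n + 3 - 2 * k = q + 3" by (simp_all add: q)
    have "x\<^sup>2 * (real q * x ^ (q - 1)) = real q * x ^ (q + 1)"
      by (cases q) (simp_all add: power2_eq_square)
    then have 1: "x\<^sup>2 * (1 - x\<^sup>2) * (real (q + 1) * (real q * x ^ (q - 1))) = (1 - x\<^sup>2) * (real (q + 1) * (real q * x ^ (q + 1)))"
      by (metis mult.assoc mult.left_commute)
    show ?thesis
      unfolding e 1 B_def A_def \<Lambda>_def by (simp add: q algebra_simps power_add power2_eq_square power3_eq_cube)
  qed
  have coeff: "gu_coeff b n (Suc k) * A (Suc k) = - gu_coeff b n k * B k" if "Suc k \<le> N" for k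
  proof -
    have "2 * Suc k \<le> n" using that unfolding N_def by presburger
    then have "2 * real k + 2 \<le> real n" using of_nat_mono[where 'a = real] by fastforce
    then have "2 * real n + 1 - 2 * real k + 2 * b > 0" using b by linarith
    moreover have "A (Suc k) = (2 * real k + 2) * (2 * real n + 1 - 2 * real k + 2 * b)"
      by (simp add: A_def algebra_simps)
    ultimately show ?thesis
      by (simp add: gu_coeff_Suc B_def p_def)
  qed
  have partial: "(\<Sum>k\<le>K. gu_coeff b n k * (B k * x ^ (n + 1 - 2 * k) + A k * x ^ (n + 3 - 2 * k))) =
      gu_coeff b n K * B K * x ^ (n + 1 - 2 * K)" if "K \<le> N" for K x
    using that
  proof (induction K)
    case (Suc K)
    have e: "n + 3 - 2 * Suc K = n + 1 - 2 * K" by simp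
    have "(\<Sum>k\<le>Suc K. gu_coeff b n k * (B k * x ^ (n + 1 - 2 * k) + A k * x ^ (n + 3 - 2 * k))) =
      (gu_coeff b n K * B K + gu_coeff b n (Suc K) * A (Suc K)) * x ^ (n + 1 - 2 * K)
      + gu_coeff b n (Suc K) * B (Suc K) * x ^ (n + 1 - 2 * Suc K)"
      using Suc unfolding sum.atMost_Suc e by (simp add: algebra_simps)
    then show ?case unfolding coeff[OF Suc.prems] by simp
  qed (simp add: A_def)
  have "real n - p - 2 * real N = 0"
    unfolding p_def N_def using div_mult_mod_eq[of n 2] by linarith
  then have "B N = 0" by (simp add: B_def)
  have ode: "x\<^sup>2 * (1 - x\<^sup>2) * G2 x - 2 * (b + 1) * x ^ 3 * G1 x + (\<Lambda> * x\<^sup>2 - p * (p + 1)) * G x = 0" for x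
  proof -
    have "x\<^sup>2 * (1 - x\<^sup>2) * G2 x - 2 * (b + 1) * x ^ 3 * G1 x + (\<Lambda> * x\<^sup>2 - p * (p + 1)) * G x =
       (\<Sum>k\<le>N. gu_coeff b n k * (x\<^sup>2 * (1 - x\<^sup>2) * (real (n + 1 - 2 * k) * (real (n - 2 * k) * x ^ (n - 2 * k - 1)))
        - 2 * (b + 1) * x ^ 3 * (real (n + 1 - 2 * k) * x ^ (n - 2 * k)) + (\<Lambda> * x\<^sup>2 - p * (p + 1)) * x ^ (n + 1 - 2 * k)))"
      unfolding G G1_def G2_def N_def[symmetric]
      by (simp only: sum_distrib_left sum.distrib sum_subtractf distrib_left right_diff_distrib mult_ac)
    also have "\<dots> = (\<Sum>k\<le>N. gu_coeff b n k * (B k * x ^ (n + 1 - 2 * k) + A k * x ^ (n + 3 - 2 * k)))"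
      by (intro sum.cong refl) (simp only: summand atMost_iff)
    also have "\<dots> = 0" using \<open>B N = 0\<close> by (subst partial) auto
    finally show ?thesis .
  qed
  show thesis
    by (rule that[OF dG dG1 ode[unfolded \<Lambda>_def]])
qed

lemma deriv_deriv_weighted:
  fixes b x :: real
  assumes G: "\<And>y. (G has_real_derivative G1 y) (at y)"
    and G1: "\<And>y. (G1 has_real_derivative G2 y) (at y)"
    and F: "\<And>y. F y = (1 - y\<^sup>2) powr (b / 2) * G y"
    and x: "-1 < x" "x < 1"
  defines "u \<equiv> 1 - x\<^sup>2"
  shows "F differentiable (at x)" "deriv F differentiable (at x)"
    and "deriv F x = u powr (b / 2) * (G1 x - b * x / u * G x)"
    and "deriv (deriv F) x = u powr (b / 2) *
           (G2 x - 2 * b * x / u * G1 x + (b\<^sup>2 * x\<^sup>2 - b * (1 + x\<^sup>2)) / u\<^sup>2 * G x)"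
proof -
  define F1 where "F1 y = (1 - y\<^sup>2) powr (b / 2) * (G1 y - b * y / (1 - y\<^sup>2) * G y)" for y
  have pos: "1 - y\<^sup>2 > 0" if "y \<in> {-1<..<1}" for y :: real
    using that by (simp add: abs_square_less_1 abs_less_iff)
  have w: "((\<lambda>y. (1 - y\<^sup>2) powr (b / 2)) has_real_derivative - (b * y / (1 - y\<^sup>2)) * (1 - y\<^sup>2) powr (b / 2)) (at y)"
    if "y \<in> {-1<..<1}" for y
  proof -
    have "((\<lambda>y. 1 - y\<^sup>2) has_real_derivative - (2 * y)) (at y)"
      by (auto intro!: derivative_eq_intros)
    from DERIV_powr[OF this pos[OF that] DERIV_const, of "b / 2"] show ?thesis
      by (rule DERIV_cong) (simp only: mult_zero_left, simp)
  qed
  have dF: "(F has_real_derivative F1 y) (at y)" if "y \<in> {-1<..<1}" for y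
    unfolding F[abs_def] F1_def
    by (rule derivative_eq_intros w[OF that] G refl)+ (simp add: algebra_simps)
  have dF1: "(F1 has_real_derivative u powr (b / 2) *
           (G2 x - 2 * b * x / u * G1 x + (b\<^sup>2 * x\<^sup>2 - b * (1 + x\<^sup>2)) / u\<^sup>2 * G x)) (at x)"
  proof -
    have "u > 0" using pos[of x] x by (simp add: u_def)
    have q: "((\<lambda>y. b * y / (1 - y\<^sup>2)) has_real_derivative b * (1 + x\<^sup>2) / u\<^sup>2) (at x)"
      using \<open>u > 0\<close> unfolding u_def
      by (auto intro!: derivative_eq_intros simp: power2_eq_square algebra_simps)
    have xI: "x \<in> {-1<..<1}" using x by simp
    show ?thesis
      unfolding F1_def[abs_def]
      by (rule DERIV_cong[OF DERIV_mult[OF w[OF xI] DERIV_diff[OF G1 DERIV_mult[OF q G]]]], fold u_def)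
        (simp add: diff_divide_distrib algebra_simps power2_eq_square)
  qed
  have ddF: "(deriv F has_real_derivative u powr (b / 2) *
           (G2 x - 2 * b * x / u * G1 x + (b\<^sup>2 * x\<^sup>2 - b * (1 + x\<^sup>2)) / u\<^sup>2 * G x)) (at x)"
    using dF1
    by (rule has_field_derivative_transform_within_open[where S = "{-1<..<1}"])
      (use x in \<open>auto simp: DERIV_imp_deriv[OF dF]\<close>)
  show "F differentiable (at x)" "deriv F differentiable (at x)"
    using dF[of x] x ddF by (auto simp: real_differentiable_def)
  show "deriv F x = u powr (b / 2) * (G1 x - b * x / u * G x)"
    using DERIV_imp_deriv[OF dF[of x]] x by (simp add: F1_def u_def)
  show "deriv (deriv F) x = u powr (b / 2) *
           (G2 x - 2 * b * x / u * G1 x + (b\<^sup>2 * x\<^sup>2 - b * (1 + x\<^sup>2)) / u\<^sup>2 * G x)"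
    by (rule DERIV_imp_deriv[OF ddF])
qed

lemma Q_ode:
  assumes b: "b > -1" and x: "-1 < x" "x < 1" "x \<noteq> 0"
  shows "Q b n differentiable (at x)" "deriv (Q b n) differentiable (at x)"
    and "(1 - x\<^sup>2) * deriv (deriv (Q b n)) x - 2 * x * deriv (Q b n) x
              + ((real n + b + 1) * (real n + b + 2) - b\<^sup>2 / (1 - x\<^sup>2)
                 - (1 - (-1) ^ n) / 2 * (2 / x\<^sup>2)) * Q b n x = 0"
proof -
  define p where "p = real (n mod 2)"
  define G where "G = (\<lambda>x. x * gu_poly b n x)"
  obtain G1 G2 where
    dG: "\<And>y. (G has_real_derivative G1 y) (at y)" and
    dG1: "\<And>y. (G1 has_real_derivative G2 y) (at y)" and
    ode: "\<And>y. y\<^sup>2 * (1 - y\<^sup>2) * G2 y - 2 * (b + 1) * y ^ 3 * G1 y +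
         (((real n + b + 1) * (real n + b + 2) - b\<^sup>2 - b) * y\<^sup>2 - p * (p + 1)) * (y * gu_poly b n y) = 0"
    by (rule gu_poly_ode[OF b, of n, folded G_def p_def]) (rule that)
  have Q: "Q b n y = (1 - y\<^sup>2) powr (b / 2) * G y" for y
    by (simp add: Q_def gen_ultraspherical_eq_gu_poly[OF b] G_def mult_ac)
  note D = deriv_deriv_weighted[OF dG dG1 Q x(1,2)]
  show "Q b n differentiable (at x)" "deriv (Q b n) differentiable (at x)"
    by (rule D)+
  define u where "u = 1 - x\<^sup>2"
  have u: "u > 0" using x by (simp add: u_def abs_square_less_1 abs_less_iff)
  have sgn: "(1 - (-1) ^ n) / 2 * (2 / x\<^sup>2) = p * (p + 1) / x\<^sup>2"
    by (simp add: p_def mod2_eq_if)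
  define \<Lambda> where "\<Lambda> = (real n + b + 1) * (real n + b + 2)"
  have x2: "x\<^sup>2 = 1 - u" by (simp add: u_def)
  define E where "E = u * (G2 x - 2 * b * x / u * G1 x + (b\<^sup>2 * x\<^sup>2 - b * (1 + x\<^sup>2)) / u\<^sup>2 * G x)
     - 2 * x * (G1 x - b * x / u * G x) + (\<Lambda> - b\<^sup>2 / u - p * (p + 1) / x\<^sup>2) * G x"
  have E1: "E = u * G2 x - 2 * (b + 1) * x * G1 x +
     (((b\<^sup>2 * x\<^sup>2 - b * (1 + x\<^sup>2)) + 2 * b * x\<^sup>2 - b\<^sup>2) / u + \<Lambda> - p * (p + 1) / x\<^sup>2) * G x"
    unfolding E_def using u by (simp add: field_simps power2_eq_square)
  have E2: "((b\<^sup>2 * x\<^sup>2 - b * (1 + x\<^sup>2)) + 2 * b * x\<^sup>2 - b\<^sup>2) / u = - b\<^sup>2 - b"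
    using u unfolding x2 by (simp add: field_simps)
  have "x\<^sup>2 * E = x\<^sup>2 * u * G2 x - 2 * (b + 1) * x ^ 3 * G1 x + ((\<Lambda> - b\<^sup>2 - b) * x\<^sup>2 - p * (p + 1)) * G x"
    unfolding E1 E2 using x by (simp add: field_simps power2_eq_square power3_eq_cube)
  also have "\<dots> = 0" using ode[of x] by (simp add: G_def \<Lambda>_def u_def)
  finally have "E = 0" using x by simp
  have "(1 - x\<^sup>2) * deriv (deriv (Q b n)) x - 2 * x * deriv (Q b n) x
              + ((real n + b + 1) * (real n + b + 2) - b\<^sup>2 / (1 - x\<^sup>2)
                 - (1 - (-1) ^ n) / 2 * (2 / x\<^sup>2)) * Q b n x = u powr (b / 2) * E"
    unfolding sgn D(3,4) Q[of x] u_def[symmetric] \<Lambda>_def[symmetric] E_def by (simp add: algebra_simps)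
  then show "(1 - x\<^sup>2) * deriv (deriv (Q b n)) x - 2 * x * deriv (Q b n) x
              + ((real n + b + 1) * (real n + b + 2) - b\<^sup>2 / (1 - x\<^sup>2)
                 - (1 - (-1) ^ n) / 2 * (2 / x\<^sup>2)) * Q b n x = 0"
    by (simp add: \<open>E = 0\<close>)
qed

theorem mainTheorem4:
  fixes b :: real
  assumes "b > -1"
  shows "(\<forall>n. \<forall>x. -1 < x \<and> x < 1 \<and> x \<noteq> 0 \<longrightarrow>
            Q b n differentiable (at x) \<and> deriv (Q b n) differentiable (at x) \<and>
            (1 - x\<^sup>2) * deriv (deriv (Q b n)) x - 2 * x * deriv (Q b n) x
              + ((real n + b + 1) * (real n + b + 2) - b\<^sup>2 / (1 - x\<^sup>2)
                 - (1 - (-1) ^ n) / 2 * (2 / x\<^sup>2)) * Q b n x = 0) \<and>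
         (\<forall>n m. set_integrable lborel {-1<..<1} (\<lambda>x. Q b n x * Q b m x) \<and>
            (LBINT x:{-1<..<1}. Q b n x * Q b m x) =
              (\<Prod>i=1..n. (real i + 1 - (-1) ^ i) * (real i + 1 - (-1) ^ i + 2 * b) /
                 ((2 * real i + 2 * b + 1) * (2 * real i + 2 * b + 3)))
              * (sqrt pi * Gamma (b + 1) / (2 * Gamma (b + 5 / 2)))
              * (if n = m then 1 else 0))"
proof (intro conjI allI impI)
  fix n :: nat and x :: real
  assume x: "-1 < x \<and> x < 1 \<and> x \<noteq> 0"
  show "Q b n differentiable (at x)" "deriv (Q b n) differentiable (at x)"
    "(1 - x\<^sup>2) * deriv (deriv (Q b n)) x - 2 * x * deriv (Q b n) x
              + ((real n + b + 1) * (real n + b + 2) - b\<^sup>2 / (1 - x\<^sup>2)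
                 - (1 - (-1) ^ n) / 2 * (2 / x\<^sup>2)) * Q b n x = 0"
    using x by (intro Q_ode[OF assms]; simp)+
qed (rule Q_orthogonal[OF assms, unfolded gu_rec_def])+

end
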